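(* Let $k \in [0,\infty)$ (bidirectional traffic, i.e. $k<\infty$), and let $\tau^*$ be the solution of $$\tau^* = \frac{k\, f\bigl(1-(1-\tau^* )^n\bigr)}{n-(n-k)\, f\bigl(1-(1-\tau^* )^n\bigr)}.$$ Then the homogeneous strategy vector $\boldsymbol\tau=(\tau^*,\tau^*,\dots,\tau^* )\in[0,1]^n$ (that is, $\tau_i=\tau^*$ for all $i$) is the only Nash equilibrium with non-null utility values of the distributed access game.
   Context: Parameters: an integer $n\ge 1$ (number of stations), real constants $P>0$ (payload) and $0<\sigma<T$ (empty and busy slot durations), an integer retry limit $R\ge 0$, contention windows $1<CW_{min}\le CW_{max}$, $W(i)=\min\{2^i CW_{min},CW_{max}\}$. Define $f:[0,1]\to(0,1)$ by $$f(p)=\frac{2(1-p^{R+1})}{1-p^{R+1}+(1-p)\sum_{i=0}^R p^iW(i)}\ \ (0\le p<1),\qquad f(1)=\frac{2(R+1)}{1+\sum_{i=0}^R W(i)}.$$ Game: each player (station) $i\in\{1,\dots,n\}$ chooses a channel access probability $\tau_i\in[0,1]$. For $\boldsymbol\tau=(\tau_1,\dots,\tau_n)\in[0,1]^n$ put $p_i=1-\prod_{j\ne i}(1-\tau_j)$, $p_{AP}=1-\prod_{j=1}^n(1-\tau_j)$, $\tau_{AP}=f(p_{AP})$ (access probability of the access point, which is not a player), $P_{idle}=(1-p_{AP})(1-\tau_{AP})$, and $$S_u^i=\frac{\tau_i(1-p_i)(1-\tau_{AP})P}{P_{idle}\sigma+(1-P_{idle})T},\qquad S_d=\frac1n\,\frac{\tau_{AP}(1-p_{AP})P}{P_{idle}\sigma+(1-P_{idle})T}$$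 (uplink throughput of station $i$ and per-station downlink throughput). The utility of station $i$ is $J_i(\boldsymbol\tau)=\min\{S_u^i,kS_d\}$, where the coefficient $k\in[0,\infty)$, common to all stations, is the desired ratio between uplink and downlink throughput. A Nash equilibrium is a vector $\boldsymbol\tau\in[0,1]^n$ such that no player $i$ can strictly increase $J_i$ by changing $\tau_i\in[0,1]$ alone. It is said to have non-null utility values if it is not the case that all utilities $J_1,\dots,J_n$ equal $0$.
   Formalization: Non-null utility values of the equilibrium are claimed only for k > 0: at k = 0 every utility is identically 0, so no Nash equilibrium with non-null utility values exists and the claim fails; the rest is proved for all k ≥ 0. *)

theory Defs
  imports Complex_Main "HOL-Library.FuncSet" "HOL-Library.Cardinality"
begin

definition cw :: "real \<Rightarrow> real \<Rightarrow> nat \<Rightarrow> real" where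
  "cw CWmin CWmax i = min (2 ^ i * CWmin) CWmax"

text \<open>The value at \<open>p = 1\<close> is a separate convention: for \<open>R > 0\<close> it is not the limit of the
  values at \<open>p < 1\<close>, which would be \<open>2 * (R + 1) / (R + 1 + (\<Sum>i\<le>R. cw CWmin CWmax i))\<close>.\<close>

definition access_prob :: "nat \<Rightarrow> real \<Rightarrow> real \<Rightarrow> real \<Rightarrow> real" where
  "access_prob R CWmin CWmax p =
     (if p = 1 then 2 * (real R + 1) / (1 + (\<Sum>i\<le>R. cw CWmin CWmax i))
      else 2 * (1 - p ^ (R + 1)) /
           (1 - p ^ (R + 1) + (1 - p) * (\<Sum>i\<le>R. p ^ i * cw CWmin CWmax i)))"

text \<open>The stations are the elements of a finite type \<open>'n\<close>, so their number is \<open>CARD('n)\<close>; a strategy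
  vector is a function on \<open>'n\<close>. The argument \<open>f\<close> is the response of the access point.\<close>

definition p_coll :: "('n::finite \<Rightarrow> real) \<Rightarrow> 'n \<Rightarrow> real" where
  "p_coll \<tau> i = 1 - (\<Prod>j\<in>UNIV - {i}. 1 - \<tau> j)"

definition p_AP :: "('n::finite \<Rightarrow> real) \<Rightarrow> real" where
  "p_AP \<tau> = 1 - (\<Prod>j\<in>UNIV. 1 - \<tau> j)"

definition tau_AP :: "(real \<Rightarrow> real) \<Rightarrow> ('n::finite \<Rightarrow> real) \<Rightarrow> real" where
  "tau_AP f \<tau> = f (p_AP \<tau>)"

definition P_idle :: "(real \<Rightarrow> real) \<Rightarrow> ('n::finite \<Rightarrow> real) \<Rightarrow> real" where
  "P_idle f \<tau> = (1 - p_AP \<tau>) * (1 - tau_AP f \<tau>)"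

definition mean_slot :: "real \<Rightarrow> real \<Rightarrow> (real \<Rightarrow> real) \<Rightarrow> ('n::finite \<Rightarrow> real) \<Rightarrow> real" where
  "mean_slot \<sigma> T f \<tau> = P_idle f \<tau> * \<sigma> + (1 - P_idle f \<tau>) * T"

definition S_up ::
  "real \<Rightarrow> real \<Rightarrow> real \<Rightarrow> (real \<Rightarrow> real) \<Rightarrow> ('n::finite \<Rightarrow> real) \<Rightarrow> 'n \<Rightarrow> real" where
  "S_up P \<sigma> T f \<tau> i =
     \<tau> i * (1 - p_coll \<tau> i) * (1 - tau_AP f \<tau>) * P / mean_slot \<sigma> T f \<tau>"

definition S_down ::
  "real \<Rightarrow> real \<Rightarrow> real \<Rightarrow> (real \<Rightarrow> real) \<Rightarrow> ('n::finite \<Rightarrow> real) \<Rightarrow> real" where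
  "S_down P \<sigma> T f \<tau> =
     1 / real CARD('n) * (tau_AP f \<tau> * (1 - p_AP \<tau>) * P / mean_slot \<sigma> T f \<tau>)"

definition utility ::
  "real \<Rightarrow> real \<Rightarrow> real \<Rightarrow> (real \<Rightarrow> real) \<Rightarrow> real \<Rightarrow> ('n::finite \<Rightarrow> real) \<Rightarrow> 'n \<Rightarrow> real" where
  "utility P \<sigma> T f k \<tau> i = min (S_up P \<sigma> T f \<tau> i) (k * S_down P \<sigma> T f \<tau>)"

definition nash_equilibrium :: "'s set \<Rightarrow> (('n \<Rightarrow> 's) \<Rightarrow> 'n \<Rightarrow> real) \<Rightarrow> ('n \<Rightarrow> 's) \<Rightarrow> bool" where
  "nash_equilibrium S J \<tau> \<longleftrightarrow>
     (\<forall>i. \<tau> i \<in> S) \<and> \<not> (\<exists>i. \<exists>x\<in>S. J (\<tau>(i := x)) i > J \<tau> i)"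

definition nonnull :: "(('n \<Rightarrow> 's) \<Rightarrow> 'n \<Rightarrow> real) \<Rightarrow> ('n \<Rightarrow> 's) \<Rightarrow> bool" where
  "nonnull J \<tau> \<longleftrightarrow> \<not> (\<forall>i. J \<tau> i = 0)"

definition homogeneous_solution :: "nat \<Rightarrow> (real \<Rightarrow> real) \<Rightarrow> real \<Rightarrow> real \<Rightarrow> bool" where
  "homogeneous_solution n f k t \<longleftrightarrow> t \<in> {0..1} \<and>
     t = k * f (1 - (1 - t) ^ n) / (real n - (real n - k) * f (1 - (1 - t) ^ n))"

text \<open>For real contention windows close to 1 the value \<open>access_prob R CWmin CWmax 1\<close> can be
  \<open>1\<close> or larger, so \<open>access_prob R CWmin CWmax \<in> {0..1} \<rightarrow> {0<..<1}\<close> is a genuine condition. It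
  holds whenever \<open>CWmin \<ge> 2\<close>, in particular for all integer contention windows greater than 1.\<close>

lemma access_prob_funcset:
  assumes "2 \<le> CWmin" and "CWmin \<le> CWmax"
  shows "access_prob R CWmin CWmax \<in> {0..1} \<rightarrow> {0<..<1}"
proof
  fix p :: real
  assume p: "p \<in> {0..1}"
  have W: "2 \<le> cw CWmin CWmax i" for i
  proof -
    have "1 * CWmin \<le> 2 ^ i * CWmin"
      using assms by (intro mult_right_mono) auto
    with assms have "2 \<le> 2 ^ i * CWmin" by linarith
    then show ?thesis using assms by (simp add: cw_def)
  qed
  show "access_prob R CWmin CWmax p \<in> {0<..<1}"
  proof (cases "p = 1")
    case True
    have "(\<Sum>i\<le>R. 2::real) \<le> (\<Sum>i\<le>R. cw CWmin CWmax i)"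
      by (intro sum_mono W)
    then show ?thesis using True by (simp add: access_prob_def field_simps)
  next
    case False
    define A where "A = 1 - p ^ (R + 1)"
    define B where "B = (1 - p) * (\<Sum>i\<le>R. p ^ i * cw CWmin CWmax i)"
    have "p ^ Suc R < 1"
      using p False power_Suc_less_one[of p R] by (cases "p = 0") auto
    then have A: "A > 0" by (simp add: A_def)
    have "(\<Sum>i\<le>R. p ^ i * 2) \<le> (\<Sum>i\<le>R. p ^ i * cw CWmin CWmax i)"
      using p W by (intro sum_mono mult_left_mono) auto
    then have "(1 - p) * (\<Sum>i\<le>R. p ^ i * 2) \<le> B"
      unfolding B_def using p by (intro mult_left_mono) auto
    moreover have "(1 - p) * (\<Sum>i\<le>R. p ^ i * 2) = 2 * A"
      using one_diff_power_eq[of p "Suc R"]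
      by (simp add: A_def lessThan_Suc_atMost sum_distrib_right[symmetric])
    ultimately have "2 * A \<le> B" by simp
    with A have "0 < 2 * A / (A + B)" "2 * A / (A + B) < 1"
      by (simp_all add: field_simps)
    then show ?thesis using False by (simp add: access_prob_def A_def B_def)
  qed
qed

end

theory Submission imports Defs begin

text \<open>With the other stations fixed, \<open>S_up\<close> is strictly increasing and \<open>S_down\<close> strictly decreasing
  in a station's own access probability, because \<open>f\<close> is nonincreasing on \<open>[0,1)\<close>: it is
  \<open>2 / (1 + m)\<close> for a weighted mean \<open>m\<close> of the nondecreasing windows \<open>W(i)\<close>, whose weights shift
  towards large \<open>i\<close> as \<open>p\<close> grows. Hence a best response with positive utility is the point where
  \<open>S_up = k * S_down\<close>, that is \<open>n \<tau>\<^sub>i (1 - h) = k h (1 - \<tau>\<^sub>i)\<close> with \<open>h = \<tau>\<^sub>A\<^sub>P\<close>. As \<open>h\<close> is common to all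
  stations, so is \<open>\<tau>\<^sub>i\<close>, and the common value solves the fixed point equation, whose two sides
  in the form above are monotone in opposite directions.\<close>

section \<open>The response of the access point\<close>

text \<open>Twice the difference of the two sides is the double sum of
  \<open>(b i * a j - a i * b j) * (w i - w j)\<close>, and no summand is negative because the two
  factors never have opposite signs. For positive sums this says that the mean of a nondecreasing
  \<open>w\<close> does not drop when the weights shift towards larger indices.\<close>

lemma Chebyshev_sum_ratio:
  fixes a b w :: "nat \<Rightarrow> real"
  assumes cross: "\<And>i j. j \<le> i \<Longrightarrow> i \<in> I \<Longrightarrow> j \<in> I \<Longrightarrow> a i * b j \<le> b i * a j"
    and w: "mono_on I w"
  shows "(\<Sum>i\<in>I. a i * w i) * (\<Sum>i\<in>I. b i) \<le> (\<Sum>i\<in>I. b i * w i) * (\<Sum>i\<in>I. a i)"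
proof -
  define c where "c i j = (b i * a j - a i * b j) * w i" for i j
  have "0 \<le> (b i * a j - a i * b j) * (w i - w j)" if "i \<in> I" "j \<in> I" for i j
  proof (cases "j \<le> i")
    case True
    with that show ?thesis
      using cross[of j i] w by (auto intro!: mult_nonneg_nonneg simp: mono_on_def)
  next
    case False
    with that show ?thesis
      using cross[of i j] w
      by (auto intro!: mult_nonpos_nonpos simp: mono_on_def mult.commute)
  qed
  then have "0 \<le> (\<Sum>i\<in>I. \<Sum>j\<in>I. (b i * a j - a i * b j) * (w i - w j))"
    by (auto intro!: sum_nonneg)
  also have "\<dots> = (\<Sum>i\<in>I. \<Sum>j\<in>I. c i j + c j i)"
    by (intro sum.cong refl) (simp add: c_def algebra_simps)
  also have "\<dots> = (\<Sum>i\<in>I. \<Sum>j\<in>I. c i j) + (\<Sum>i\<in>I. \<Sum>j\<in>I. c j i)"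
    by (simp add: sum.distrib)
  also have "(\<Sum>i\<in>I. \<Sum>j\<in>I. c j i) = (\<Sum>i\<in>I. \<Sum>j\<in>I. c i j)"
    by (rule sum.swap)
  finally have "0 \<le> (\<Sum>i\<in>I. \<Sum>j\<in>I. c i j)"
    by simp
  also have "\<dots> = (\<Sum>i\<in>I. b i * w i) * (\<Sum>i\<in>I. a i) - (\<Sum>i\<in>I. a i * w i) * (\<Sum>i\<in>I. b i)"
    unfolding sum_product sum_subtractf[symmetric] c_def
    by (intro sum.cong refl) (simp add: algebra_simps)
  finally show ?thesis
    by simp
qed

lemma mono_cw:
  assumes "0 \<le> CWmin"
  shows "mono (cw CWmin CWmax)"
proof
  fix i j :: nat
  assume "i \<le> j"
  then have "2 ^ i * CWmin \<le> 2 ^ j * CWmin"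
    using assms by (intro mult_right_mono) auto
  then show "cw CWmin CWmax i \<le> cw CWmin CWmax j"
    by (simp add: cw_def min_le_iff_disj)
qed

lemma cw_nonneg:
  assumes "0 \<le> CWmin" "CWmin \<le> CWmax"
  shows "0 \<le> cw CWmin CWmax i"
  using assms by (simp add: cw_def)

lemma sum_power_pos:
  fixes p :: real
  assumes "0 \<le> p"
  shows "0 < (\<Sum>i\<le>R. p ^ i)"
proof -
  have "0 < p ^ 0" by simp
  also have "p ^ 0 \<le> (\<Sum>i\<le>R. p ^ i)"
    by (rule member_le_sum) (use assms in auto)
  finally show ?thesis .
qed

text \<open>The geometric sum turns \<open>1 - p ^ (R + 1)\<close> into a multiple of
  \<open>1 - p\<close>, which then cancels. At \<open>p = 1\<close> the formula is false for
  \<open>R > 0\<close>, which is why monotonicity and continuity are established on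
  \<open>[0,1)\<close> only.\<close>

lemma access_prob_weighted_mean:
  assumes "0 \<le> p" "p < 1"
  shows "access_prob R CWmin CWmax p =
    2 / (1 + (\<Sum>i\<le>R. p ^ i * cw CWmin CWmax i) / (\<Sum>i\<le>R. p ^ i))"
proof -
  have "1 - p ^ (R + 1) = (1 - p) * (\<Sum>i\<le>R. p ^ i)"
    using one_diff_power_eq[of p "Suc R"] by (simp add: lessThan_Suc_atMost)
  then have "access_prob R CWmin CWmax p = (1 - p) * (2 * (\<Sum>i\<le>R. p ^ i)) /
      ((1 - p) * ((\<Sum>i\<le>R. p ^ i) + (\<Sum>i\<le>R. p ^ i * cw CWmin CWmax i)))"
    using assms unfolding access_prob_def distrib_left by (simp only: mult.left_commute) simp
  also have "\<dots> = 2 * (\<Sum>i\<le>R. p ^ i) /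
      ((\<Sum>i\<le>R. p ^ i) + (\<Sum>i\<le>R. p ^ i * cw CWmin CWmax i))"
    using assms by simp
  also have "\<dots> = 2 / (1 + (\<Sum>i\<le>R. p ^ i * cw CWmin CWmax i) / (\<Sum>i\<le>R. p ^ i))"
  proof -
    have "2 * S / (S + A) = 2 / (1 + A / S)" if "0 < S" for S A :: real
    proof -
      have "1 + A / S = (S + A) / S"
        using that by (simp add: add_divide_distrib)
      then show ?thesis by simp
    qed
    then show ?thesis
      using sum_power_pos[OF assms(1)] by blast
  qed
  finally show ?thesis .
qed

lemma weighted_mean_cw_nonneg:
  assumes "0 \<le> CWmin" "CWmin \<le> CWmax" "0 \<le> p"
  shows "0 \<le> (\<Sum>i\<le>R. p ^ i * cw CWmin CWmax i) / (\<Sum>i\<le>R. p ^ i)"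
  using assms cw_nonneg[OF assms(1,2)]
  by (intro divide_nonneg_nonneg sum_nonneg mult_nonneg_nonneg zero_le_power)

text \<open>The weights \<open>q ^ i\<close> favour large \<open>i\<close> more than the weights
  \<open>p ^ i\<close>, so the mean window is larger at \<open>q\<close>. The endpoint
  \<open>q = 1\<close> must stay out: for \<open>R > 0\<close> the function jumps upwards
  there.\<close>

lemma access_prob_antimono:
  assumes "0 \<le> CWmin" "CWmin \<le> CWmax" "0 \<le> p" "p \<le> q" "q < 1"
  shows "access_prob R CWmin CWmax q \<le> access_prob R CWmin CWmax p"
proof -
  \<comment> \<open>The monotonicity of the weight ratio is stated cross-multiplied, so
    \<open>p = 0\<close> needs no special treatment; after splitting off
    \<open>p ^ j * q ^ j\<close> it is just \<open>p ^ (i - j) \<le> q ^ (i - j)\<close>.\<close>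
  have cross: "p ^ i * q ^ j \<le> q ^ i * p ^ j" if "j \<le> i" for i j :: nat
  proof -
    have "p ^ i * q ^ j = p ^ (i - j) * (p ^ j * q ^ j)"
      using that by (simp add: power_add[symmetric])
    also have "\<dots> \<le> q ^ (i - j) * (p ^ j * q ^ j)"
      using assms by (intro mult_right_mono power_mono) auto
    also have "\<dots> = q ^ i * p ^ j"
      using that by (simp add: power_add[symmetric])
    finally show ?thesis .
  qed
  have "(\<Sum>i\<le>R. p ^ i * cw CWmin CWmax i) * (\<Sum>i\<le>R. q ^ i)
      \<le> (\<Sum>i\<le>R. q ^ i * cw CWmin CWmax i) * (\<Sum>i\<le>R. p ^ i)"
    by (rule Chebyshev_sum_ratio)
      (use cross mono_cw[OF assms(1), of CWmax] in \<open>auto intro: mono_on_subset\<close>)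
  then have "(\<Sum>i\<le>R. p ^ i * cw CWmin CWmax i) / (\<Sum>i\<le>R. p ^ i)
      \<le> (\<Sum>i\<le>R. q ^ i * cw CWmin CWmax i) / (\<Sum>i\<le>R. q ^ i)"
    using sum_power_pos[of p R] sum_power_pos[of q R] assms by (simp add: field_simps)
  then have "2 / (1 + (\<Sum>i\<le>R. q ^ i * cw CWmin CWmax i) / (\<Sum>i\<le>R. q ^ i))
      \<le> 2 / (1 + (\<Sum>i\<le>R. p ^ i * cw CWmin CWmax i) / (\<Sum>i\<le>R. p ^ i))"
    using weighted_mean_cw_nonneg[OF assms(1-3), of R]
    by (intro divide_left_mono mult_pos_pos) linarith+
  moreover have "0 \<le> q" "p < 1" using assms by auto
  ultimately show ?thesis
    using assms by (simp only: access_prob_weighted_mean)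
qed

lemma continuous_on_access_prob:
  assumes "0 \<le> CWmin" "CWmin \<le> CWmax"
  shows "continuous_on {0..<1} (access_prob R CWmin CWmax)"
proof -
  have "1 + (\<Sum>i\<le>R. p ^ i * cw CWmin CWmax i) / (\<Sum>i\<le>R. p ^ i) \<noteq> 0" if "0 \<le> p" for p :: real
    using weighted_mean_cw_nonneg[OF assms that, of R] by linarith
  moreover have "(\<Sum>i\<le>R. p ^ i) \<noteq> 0" if "0 \<le> p" for p :: real
    using sum_power_pos[OF that, of R] by simp
  ultimately have "continuous_on {0..<1::real}
      (\<lambda>p. 2 / (1 + (\<Sum>i\<le>R. p ^ i * cw CWmin CWmax i) / (\<Sum>i\<le>R. p ^ i)))"
    by (intro continuous_intros) auto
  moreover have "continuous_on {0..<1} (access_prob R CWmin CWmax) \<longleftrightarrow> continuous_on {0..<1::real}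
      (\<lambda>p. 2 / (1 + (\<Sum>i\<le>R. p ^ i * cw CWmin CWmax i) / (\<Sum>i\<le>R. p ^ i)))"
    by (intro continuous_on_cong) (auto simp: access_prob_weighted_mean)
  ultimately show ?thesis
    by simp
qed

section \<open>Maximising the minimum of an increasing and a decreasing function\<close>

text \<open>If the maximiser lies where one function is strictly smaller, a small move in the
  direction that raises this function keeps the other one above the old minimum. Room to the right
  comes from the half-open interval, room to the left from \<open>start\<close>, which rules out
  \<open>D m < U m\<close> at \<open>m = 0\<close>.\<close>

lemma max_min_at_crossing:
  fixes U D :: "real \<Rightarrow> real"
  assumes U: "strict_mono_on {0..<1} U" "continuous_on {0..<1} U"
    and D: "strict_antimono_on {0..<1} D" "continuous_on {0..<1} D"
    and start: "U 0 \<le> D 0"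
    and m: "m \<in> {0..<1}"
    and max: "\<And>x. x \<in> {0..<1} \<Longrightarrow> min (U x) (D x) \<le> min (U m) (D m)"
  shows "U m = D m"
proof (rule ccontr)
  assume "U m \<noteq> D m"
  then consider "U m < D m" | "D m < U m" by linarith
  then show False
  proof cases
    case 1
    have "continuous_on {m..<1} D"
      using D(2) m by (auto intro: continuous_on_subset)
    then have "(D \<longlongrightarrow> D m) (at m within {m..<1})"
      using m by (auto simp: continuous_on_def)
    moreover have "at m within {m..<1} = at_right m"
      using m by (intro at_within_nhd[of m "{..<1}"]) auto
    ultimately have "\<forall>\<^sub>F x in at_right m. U m < D x"
      using 1 by (auto intro: order_tendstoD)
    moreover have "\<forall>\<^sub>F x in at_right m. x \<in> {m<..<1}"
      using m by (intro eventually_at_right_less eventually_at_rightI) auto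
    ultimately have "\<forall>\<^sub>F x in at_right m. U m < D x \<and> x \<in> {m<..<1}"
      by (rule eventually_conj)
    then obtain x where x: "U m < D x" "m < x" "x < 1"
      using eventually_happens'[OF trivial_limit_at_right_real] by fastforce
    then have "U m < U x"
      using U(1) m by (auto simp: strict_mono_on_def)
    then show False
      using max[of x] x m 1 by auto
  next
    case 2
    with start have "m \<noteq> 0" by auto
    with m have "0 < m" by simp
    have "continuous_on {0..m} U"
      using U(2) m by (auto intro: continuous_on_subset)
    then have "(U \<longlongrightarrow> U m) (at m within {0..m})"
      using m by (auto simp: continuous_on_def)
    moreover have "at m within {0..m} = at_left m"
      using \<open>0 < m\<close> by (intro at_within_nhd[of m "{0<..}"]) auto
    ultimately have "\<forall>\<^sub>F x in at_left m. D m < U x"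
      using 2 by (auto intro: order_tendstoD)
    moreover have "\<forall>\<^sub>F x in at_left m. x \<in> {0<..<m}"
      using \<open>0 < m\<close> by (intro eventually_at_leftI) auto
    ultimately have "\<forall>\<^sub>F x in at_left m. D m < U x \<and> x \<in> {0<..<m}"
      by (rule eventually_conj)
    then obtain x where x: "D m < U x" "0 < x" "x < m"
      using eventually_happens'[OF trivial_limit_at_left_real] by fastforce
    then have "D m < D x"
      using D(1) m by (auto simp: monotone_on_def)
    then show False
      using max[of x] x m 2 by auto
  qed
qed

section \<open>The access game\<close>

definition others_idle :: "('n::finite \<Rightarrow> real) \<Rightarrow> 'n \<Rightarrow> real" where
  "others_idle \<tau> i = (\<Prod>j\<in>UNIV - {i}. 1 - \<tau> j)"

lemma others_idle_fun_upd [simp]: "others_idle (\<tau>(i := x)) i = others_idle \<tau> i"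
  unfolding others_idle_def by (intro prod.cong) auto

lemma others_idle_le_1:
  assumes "\<And>j. \<tau> j \<in> {0..1}"
  shows "others_idle \<tau> i \<le> 1"
  unfolding others_idle_def using assms by (intro prod_le_1) auto

lemma others_idle_nonneg:
  assumes "\<And>j. \<tau> j \<in> {0..1}"
  shows "0 \<le> others_idle \<tau> i"
  unfolding others_idle_def using assms by (intro prod_nonneg) auto

lemma p_coll_eq: "p_coll \<tau> i = 1 - others_idle \<tau> i"
  by (simp add: p_coll_def others_idle_def)

lemma p_AP_eq: "p_AP \<tau> = 1 - (1 - \<tau> i) * others_idle \<tau> i"
  by (simp add: p_AP_def others_idle_def prod.remove[of UNIV i])

lemma p_AP_const: "p_AP (\<lambda>_::'n::finite. t) = 1 - (1 - t) ^ CARD('n)"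
  by (simp add: p_AP_def)

text \<open>This collects what the game needs to know about the response function. Nothing relates
  the value at 1 to the values below 1, except that both lie in \<open>(0,1)\<close>.\<close>

locale access_game =
  fixes P \<sigma> T k :: real and f :: "real \<Rightarrow> real"
  assumes P_pos: "0 < P" and sigma_pos: "0 < \<sigma>" and sigma_less: "\<sigma> < T"
    and k_nonneg: "0 \<le> k"
    and f_pos: "\<And>p. p \<in> {0..1} \<Longrightarrow> 0 < f p"
    and f_less_1: "\<And>p. p \<in> {0..1} \<Longrightarrow> f p < 1"
    and f_antimono: "\<And>p q. 0 \<le> p \<Longrightarrow> p \<le> q \<Longrightarrow> q < 1 \<Longrightarrow> f q \<le> f p"
    and f_cont: "continuous_on {0..<1} f"
begin

text \<open>The mean slot duration, written in terms of the probability \<open>y = 1 - p_AP\<close>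
  that no station transmits.\<close>

definition slot :: "real \<Rightarrow> real" where
  "slot y = T - (T - \<sigma>) * (y * (1 - f (1 - y)))"

text \<open>The uplink throughput without the factor \<open>P\<close>: \<open>x\<close> is the
  station's own access probability and \<open>Q\<close> the probability that all other stations are
  silent, which a unilateral deviation leaves fixed. Likewise \<open>down\<close> is the downlink
  throughput without \<open>P\<close> and without the division by the number of stations.\<close>

definition up :: "real \<Rightarrow> real \<Rightarrow> real" where
  "up Q x = x * Q * (1 - f (1 - (1 - x) * Q)) / slot ((1 - x) * Q)"

definition down :: "real \<Rightarrow> real" where
  "down y = f (1 - y) * y / slot y"

lemma slot_pos:
  assumes "y \<in> {0..1}"
  shows "0 < slot y"
proof -
  have "y * (1 - f (1 - y)) \<le> 1"
    using assms f_pos[of "1 - y"] f_less_1[of "1 - y"] by (intro mult_le_one) auto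
  then have "(T - \<sigma>) * (y * (1 - f (1 - y))) \<le> (T - \<sigma>) * 1"
    using sigma_less by (intro mult_left_mono) auto
  then show ?thesis
    using sigma_pos by (simp add: slot_def)
qed

lemma S_up_eq: "S_up P \<sigma> T f \<tau> i = P * up (others_idle \<tau> i) (\<tau> i)"
proof -
  have "mean_slot \<sigma> T f \<tau> = slot ((1 - \<tau> i) * others_idle \<tau> i)"
    by (simp add: mean_slot_def P_idle_def tau_AP_def slot_def p_AP_eq[of _ i] algebra_simps)
  then show ?thesis
    by (simp add: S_up_def up_def p_coll_eq tau_AP_def p_AP_eq[of _ i])
qed

lemma S_down_eq:
  fixes \<tau> :: "'n::finite \<Rightarrow> real"
  shows "S_down P \<sigma> T f \<tau> = P / CARD('n) * down (1 - p_AP \<tau>)"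
proof -
  have "mean_slot \<sigma> T f \<tau> = slot (1 - p_AP \<tau>)"
    by (simp add: mean_slot_def P_idle_def tau_AP_def slot_def algebra_simps)
  then show ?thesis
    by (simp add: S_down_def down_def tau_AP_def)
qed

section \<open>Sign and monotonicity of the throughputs\<close>

lemma up_0 [simp]: "up Q 0 = 0"
  by (simp add: up_def)

lemma down_0 [simp]: "down 0 = 0"
  by (simp add: down_def)

lemma down_pos:
  assumes "0 < y" "y \<le> 1"
  shows "0 < down y"
  unfolding down_def using assms f_pos[of "1 - y"] slot_pos[of y]
  by (intro divide_pos_pos mult_pos_pos) auto

lemma down_nonneg:
  assumes "0 \<le> y" "y \<le> 1"
  shows "0 \<le> down y"
  using assms down_pos[of y] by (cases "y = 0") auto

lemma idle_in_unit:
  assumes "0 \<le> x" "x \<le> 1" "0 \<le> Q" "Q \<le> 1"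
  shows "(1 - x) * Q \<in> {0..1::real}"
  using assms by (auto intro: mult_le_one)

text \<open>A larger own access probability raises the collision probability seen by the access
  point, so \<open>f\<close> does not grow and \<open>u \<le> v\<close>. The numerator therefore
  increases; the slot duration may increase too, but by less, because
  \<open>(T - \<sigma>) * (Q * u) < T\<close>.\<close>

lemma up_strict_mono:
  assumes "0 < Q" "Q \<le> 1" "0 \<le> x" "x < y" "y < 1"
  shows "up Q x < up Q y"
proof -
  define u v where "u = 1 - f (1 - (1 - x) * Q)" and "v = 1 - f (1 - (1 - y) * Q)"
  have xQ: "(1 - x) * Q \<in> {0..1}" and yQ: "(1 - y) * Q \<in> {0..1}"
    using assms idle_in_unit[of x Q] idle_in_unit[of y Q] by simp_all
  have le: "(1 - y) * Q \<le> (1 - x) * Q" and pos: "0 < (1 - y) * Q"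
    using assms by auto
  have u: "0 < u" "u < 1" and v: "0 < v" "v < 1"
    unfolding u_def v_def using xQ yQ f_pos f_less_1 by auto
  have uv: "u \<le> v"
    unfolding u_def v_def using xQ le pos
      f_antimono[of "1 - (1 - x) * Q" "1 - (1 - y) * Q"] by auto
  have "(T - \<sigma>) * (Q * u) < T"
  proof -
    have "(T - \<sigma>) * (Q * u) \<le> (T - \<sigma>) * 1"
      using assms u sigma_less by (intro mult_left_mono mult_le_one) auto
    then show ?thesis using sigma_pos by simp
  qed
  then have "(T - \<sigma>) * (Q * u) * (v * (y - x)) < T * (v * (y - x))"
    using v assms by (intro mult_strict_right_mono) auto
  also have "\<dots> \<le> T * (y * v - x * u)"
    using assms uv sigma_pos sigma_less mult_left_mono[OF uv, of x]
    by (intro mult_left_mono) (auto simp: algebra_simps)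
  \<comment> \<open>This is the difference of the cross-multiplied fractions; the mixed terms
    collapse through \<open>y * (1 - x) - x * (1 - y) = y - x\<close>.\<close>
  finally have "0 < Q * (T * (y * v - x * u) - (T - \<sigma>) * (Q * u) * (v * (y - x)))"
    using assms by simp
  then have "x * Q * u * (T - (T - \<sigma>) * ((1 - y) * Q * v))
      < y * Q * v * (T - (T - \<sigma>) * ((1 - x) * Q * u))"
    by (simp add: algebra_simps)
  then have "x * Q * u * slot ((1 - y) * Q) < y * Q * v * slot ((1 - x) * Q)"
    by (simp only: slot_def u_def v_def)
  then show ?thesis
    unfolding up_def u_def[symmetric] v_def[symmetric]
    using slot_pos[OF xQ] slot_pos[OF yQ] by (simp only: divide_less_eq less_divide_eq if_True
        times_divide_eq_left)
qed

lemma down_strict_mono: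
  assumes "0 \<le> a" "a < b" "b \<le> 1"
  shows "down a < down b"
proof (cases "a = 0")
  \<comment> \<open>Here \<open>f\<close> is evaluated at 1, outside the range of
    \<open>f_antimono\<close>, but the factor \<open>a = 0\<close> makes its value
    irrelevant.\<close>
  case True
  then show ?thesis using assms down_pos[of b] by simp
next
  case False
  define g h where "g = f (1 - a)" and "h = f (1 - b)"
  have h: "0 < h"
    unfolding h_def using assms f_pos by auto
  have gh: "g \<le> h"
    unfolding g_def h_def using assms False by (intro f_antimono) auto
  \<comment> \<open>After cross-multiplication the claim compares \<open>T * (h * b - g * a)\<close>
    with \<open>(T - \<sigma>) * a * b * (h - g)\<close>, where \<open>h * b - g * a\<close> splits
    into \<open>h * (b - a)\<close> and \<open>a * (h - g)\<close>.\<close>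
  have "(T - \<sigma>) * (b * (a * (h - g))) \<le> T * (1 * (a * (h - g)))"
    using assms gh sigma_pos sigma_less by (intro mult_mono mult_right_mono) auto
  also have "\<dots> < T * (h * (b - a)) + T * (1 * (a * (h - g)))"
    using assms h sigma_pos sigma_less by simp
  finally have "g * a * slot b < h * b * slot a"
    by (simp add: slot_def g_def[symmetric] h_def[symmetric] algebra_simps)
  then show ?thesis
    using slot_pos[of a] slot_pos[of b] assms
    by (simp add: down_def g_def[symmetric] h_def[symmetric] divide_simps mult_ac)
qed

section \<open>Continuity of the throughputs in the own access probability\<close>

lemma continuous_on_f_idle:
  assumes "0 < Q" "Q \<le> 1"
  shows "continuous_on {0..<1} (\<lambda>x. f (1 - (1 - x) * Q))"
  \<comment> \<open>For \<open>x < 1\<close> and \<open>Q > 0\<close> the argument of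
    \<open>f\<close> stays below 1, inside the range of \<open>f_cont\<close>.\<close>
  using assms idle_in_unit
  by (intro continuous_on_compose2[OF f_cont] continuous_intros) fastforce

lemma continuous_on_slot:
  assumes "0 < Q" "Q \<le> 1"
  shows "continuous_on {0..<1} (\<lambda>x. slot ((1 - x) * Q))"
  unfolding slot_def by (intro continuous_intros continuous_on_f_idle assms)

lemma slot_idle_nonzero:
  assumes "0 < Q" "Q \<le> 1" "x \<in> {0..<1}"
  shows "slot ((1 - x) * Q) \<noteq> 0"
  using assms idle_in_unit[of x Q] slot_pos[of "(1 - x) * Q"] by auto

lemma continuous_on_up:
  assumes "0 < Q" "Q \<le> 1"
  shows "continuous_on {0..<1} (up Q)"
  unfolding up_def
  using slot_idle_nonzero assms
  by (intro continuous_intros continuous_on_f_idle continuous_on_slot) auto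

lemma continuous_on_down:
  assumes "0 < Q" "Q \<le> 1"
  shows "continuous_on {0..<1} (\<lambda>x. down ((1 - x) * Q))"
  unfolding down_def
  using slot_idle_nonzero assms
  by (intro continuous_intros continuous_on_f_idle continuous_on_slot) auto

text \<open>Both throughputs carry the positive factor \<open>Q / (n * s)\<close>. Once it is
  cancelled, the other stations enter only through \<open>h\<close>, the access probability of the
  access point.\<close>

lemma up_eq_down_iff:
  assumes "0 < Q" "Q \<le> 1" "0 \<le> x" "x \<le> 1" "0 < n"
  defines "h \<equiv> f (1 - (1 - x) * Q)"
  shows "up Q x = k / n * down ((1 - x) * Q) \<longleftrightarrow> n * (x * (1 - h)) = k * (h * (1 - x))"
proof -
  define s where "s = slot ((1 - x) * Q)"
  have "0 < s"
    unfolding s_def using assms idle_in_unit[of x Q] by (intro slot_pos) auto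
  have "up Q x = x * Q * (1 - h) / s"
    by (simp add: up_def h_def s_def)
  also have "\<dots> = n * (x * (1 - h)) * (Q / (n * s))"
    using \<open>0 < n\<close> by simp
  finally have up: "up Q x = n * (x * (1 - h)) * (Q / (n * s))" .
  have "k / n * down ((1 - x) * Q) = k / n * (h * ((1 - x) * Q) / s)"
    by (simp add: down_def h_def s_def)
  also have "\<dots> = k * (h * (1 - x)) * (Q / (n * s))"
    by simp
  finally have down: "k / n * down ((1 - x) * Q) = k * (h * (1 - x)) * (Q / (n * s))" .
  show ?thesis
    unfolding up down using \<open>0 < n\<close> \<open>0 < s\<close> assms(1) by (simp only: mult_cancel_right) simp
qed

lemma utility_fun_upd:
  fixes \<tau> :: "'n::finite \<Rightarrow> real"
  shows "utility P \<sigma> T f k (\<tau>(i := x)) i = P * min (up (others_idle \<tau> i) x)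
    (k / CARD('n) * down ((1 - x) * others_idle \<tau> i))"
proof -
  have "utility P \<sigma> T f k (\<tau>(i := x)) i = min (P * up (others_idle \<tau> i) x)
      (P * (k / CARD('n) * down ((1 - x) * others_idle \<tau> i)))"
    by (simp add: utility_def S_up_eq S_down_eq p_AP_eq[of _ i] mult.left_commute)
  then show ?thesis
    using P_pos by (simp add: min_mult_distrib_left)
qed

lemma utility_eq:
  fixes \<tau> :: "'n::finite \<Rightarrow> real"
  shows "utility P \<sigma> T f k \<tau> i = P * min (up (others_idle \<tau> i) (\<tau> i))
    (k / CARD('n) * down ((1 - \<tau> i) * others_idle \<tau> i))"
  using utility_fun_upd[of \<tau> i "\<tau> i"] by simp

section \<open>The fixed point equation\<close>

text \<open>The denominator equals \<open>n * (1 - h) + k * h\<close> and is positive, so it can be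
  cleared, which yields the crossing equation of \<open>up_eq_down_iff\<close>. At
  \<open>t = 1\<close> that equation would force \<open>n * (1 - h) = 0\<close>, so solutions lie
  where \<open>f\<close> is known to be monotone and continuous.\<close>

lemma homogeneous_solution_iff:
  assumes "0 < n"
  shows "homogeneous_solution n f k t \<longleftrightarrow> t \<in> {0..<1} \<and>
    n * (t * (1 - f (1 - (1 - t) ^ n))) = k * (f (1 - (1 - t) ^ n) * (1 - t))"
proof (cases "t \<in> {0..1}")
  case True
  define h where "h = f (1 - (1 - t) ^ n)"
  have h: "0 < h" "h < 1"
    unfolding h_def using True by (auto intro!: f_pos f_less_1 power_le_one)
  have "0 < n * (1 - h) + k * h"
    using assms h k_nonneg by (intro add_pos_nonneg mult_pos_pos) auto
  then have "0 < real n - (real n - k) * h"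
    by (simp add: algebra_simps)
  then have "homogeneous_solution n f k t \<longleftrightarrow> n * (t * (1 - h)) = k * (h * (1 - t))"
    using True by (auto simp: homogeneous_solution_def h_def[symmetric] field_simps)
  moreover have "t \<noteq> 1" if "n * (t * (1 - h)) = k * (h * (1 - t))"
    using that assms h by auto
  ultimately show ?thesis
    using True by (auto simp: h_def)
qed (auto simp: homogeneous_solution_def)

lemma power_idle_bounds:
  fixes t :: real
  assumes "t \<in> {0..<1}"
  shows "0 < (1 - t) ^ n" "(1 - t) ^ n \<le> 1"
  using assms by (auto intro: power_le_one)

text \<open>Used in both directions, this gives uniqueness. From \<open>s\<close> to a larger
  \<open>t\<close> the left side of the cleared equation strictly grows, while the right side does
  not.\<close>

lemma homogeneous_solution_le:
  assumes "0 < n" "homogeneous_solution n f k s" "homogeneous_solution n f k t"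
  shows "t \<le> s"
proof (rule ccontr)
  assume "\<not> t \<le> s"
  then have "s < t" by simp
  define g h where "g = f (1 - (1 - s) ^ n)" and "h = f (1 - (1 - t) ^ n)"
  have s: "s \<in> {0..<1}" "n * (s * (1 - g)) = k * (g * (1 - s))"
    and t: "t \<in> {0..<1}" "n * (t * (1 - h)) = k * (h * (1 - t))"
    using assms by (auto simp: homogeneous_solution_iff g_def h_def)
  note bnd = power_idle_bounds[OF s(1), of n] power_idle_bounds[OF t(1), of n]
  have h: "0 < h" "h < 1" and g: "0 < g" "g < 1"
    unfolding h_def g_def using bnd f_pos f_less_1 by auto
  have "h \<le> g"
    unfolding h_def g_def using bnd s t \<open>s < t\<close>
    by (intro f_antimono) (auto intro!: power_mono)
  have "n * (s * (1 - g)) \<le> n * (s * (1 - h))"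
    using s \<open>h \<le> g\<close> by (intro mult_left_mono) auto
  also have "\<dots> < n * (t * (1 - h))"
    using h \<open>s < t\<close> assms(1) by simp
  also have "\<dots> = k * (h * (1 - t))" by (fact t)
  also have "\<dots> \<le> k * (g * (1 - s))"
    using k_nonneg h g \<open>h \<le> g\<close> \<open>s < t\<close> t by (intro mult_left_mono mult_mono) auto
  also have "\<dots> = n * (s * (1 - g))" using s by simp
  finally show False by simp
qed

text \<open>The equation is only continuous on \<open>[0,1)\<close>. The intermediate value theorem is applied up to
  the point where it would hold if \<open>f\<close> were constantly \<open>f 0\<close>, its maximum on \<open>[0,1)\<close>.\<close>

lemma homogeneous_solution_exists:
  assumes "0 < n"
  shows "\<exists>t. homogeneous_solution n f k t"
proof -
  define F where "F t = n * (t * (1 - f (1 - (1 - t) ^ n))) -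
    k * (f (1 - (1 - t) ^ n) * (1 - t))" for t
  define b where "b = k * f 0 / (n * (1 - f 0) + k * f 0)"
  have f0: "0 < f 0" "f 0 < 1"
    using f_pos[of 0] f_less_1[of 0] by auto
  have den: "0 < n * (1 - f 0)" "0 \<le> k * f 0"
    using assms f0 k_nonneg by auto
  then have b: "0 \<le> b" "b < 1"
    unfolding b_def by (auto simp: divide_simps)
  have b_eq: "n * (b * (1 - f 0)) = k * (f 0 * (1 - b))"
  proof -
    have "b * (n * (1 - f 0) + k * f 0) = k * f 0"
      using den unfolding b_def by simp
    then show ?thesis by (simp add: algebra_simps)
  qed
  \<comment> \<open>By construction \<open>b\<close> balances the equation for the constant response
    \<open>f 0\<close>. The actual response \<open>h\<close> is no larger, which raises the left
    side and lowers the right side, so \<open>F b\<close> is nonnegative.\<close>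
  define h where "h = f (1 - (1 - b) ^ n)"
  have "h \<le> f 0"
    unfolding h_def using power_idle_bounds[of b n] b by (intro f_antimono) auto
  then have "k * (h * (1 - b)) \<le> k * (f 0 * (1 - b))"
    using b k_nonneg by (intro mult_left_mono mult_right_mono) auto
  moreover have "n * (b * (1 - f 0)) \<le> n * (b * (1 - h))"
    using b \<open>h \<le> f 0\<close> by (intro mult_left_mono) auto
  ultimately have "0 \<le> F b"
    using b_eq by (simp add: F_def h_def)
  moreover have "F 0 \<le> 0"
    using k_nonneg f0 by (simp add: F_def)
  moreover have "continuous_on {0..b} F"
  proof -
    have "continuous_on {0..b} (\<lambda>t. f (1 - (1 - t) ^ n))"
      using b power_idle_bounds[of _ n]
      by (intro continuous_on_compose2[OF f_cont] continuous_intros) auto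
    then show ?thesis
      unfolding F_def by (intro continuous_intros)
  qed
  ultimately obtain t where "0 \<le> t" "t \<le> b" "F t = 0"
    using IVT'[of F 0 0 b] b by auto
  then show ?thesis
    using b assms by (auto simp: homogeneous_solution_iff F_def intro!: exI[of _ t])
qed

section \<open>Nash equilibria\<close>

text \<open>At \<open>t\<close> the uplink and the scaled downlink throughput of every station
  coincide. Deviating downwards lowers the former, deviating upwards does not raise the latter, so
  neither improves the minimum. For \<open>k = 0\<close> all utilities vanish, hence the condition
  in the second claim.\<close>

lemma homogeneous_nash_equilibrium:
  assumes "homogeneous_solution CARD('n) f k t"
  shows "nash_equilibrium {0..1} (utility P \<sigma> T f k) (\<lambda>_::'n::finite. t)"
    and "0 < k \<Longrightarrow> nonnull (utility P \<sigma> T f k) (\<lambda>_::'n. t)"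
proof -
  define \<tau> :: "'n \<Rightarrow> real" where "\<tau> = (\<lambda>_. t)"
  define D where "D Q x = k / CARD('n) * down ((1 - x) * Q)" for Q x
  have t: "t \<in> {0..<1}"
    using assms by (simp add: homogeneous_solution_iff)
  have Q: "0 < others_idle \<tau> i" "others_idle \<tau> i \<le> 1" for i
    using t by (auto simp: others_idle_def \<tau>_def intro: power_le_one)
  have Q_const: "1 - (1 - t) * others_idle \<tau> i = 1 - (1 - t) ^ CARD('n)" for i
    using p_AP_eq[of \<tau> i] p_AP_const[where 'n = 'n, of t] by (simp add: \<tau>_def)
  have cross: "up (others_idle \<tau> i) t = D (others_idle \<tau> i) t" for i
    unfolding D_def using assms t Q
    by (subst up_eq_down_iff) (auto simp: Q_const homogeneous_solution_iff)
  have util: "utility P \<sigma> T f k \<tau> i = P * D (others_idle \<tau> i) t" for i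
    using utility_eq[of \<tau> i] cross[of i] by (simp add: D_def \<tau>_def)
  have "utility P \<sigma> T f k (\<tau>(i := x)) i \<le> utility P \<sigma> T f k \<tau> i" if "x \<in> {0..1}" for i x
  proof -
    have "min (up (others_idle \<tau> i) x) (D (others_idle \<tau> i) x) \<le> D (others_idle \<tau> i) t"
    proof (cases x t rule: linorder_cases)
      case less
      then have "up (others_idle \<tau> i) x < D (others_idle \<tau> i) t"
        using up_strict_mono[of "others_idle \<tau> i" x t] Q t that by (auto simp: cross)
      then show ?thesis by auto
    next
      case equal
      then show ?thesis by simp
    next
      case greater
      then have "down ((1 - x) * others_idle \<tau> i) < down ((1 - t) * others_idle \<tau> i)"
        using Q[of i] t that idle_in_unit[of t "others_idle \<tau> i"]
        by (intro down_strict_mono) auto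
      then have "D (others_idle \<tau> i) x \<le> D (others_idle \<tau> i) t"
        unfolding D_def using k_nonneg by (intro mult_left_mono) auto
      then show ?thesis by auto
    qed
    then show ?thesis
      unfolding utility_fun_upd util D_def using P_pos by (intro mult_left_mono) auto
  qed
  then show "nash_equilibrium {0..1} (utility P \<sigma> T f k) (\<lambda>_::'n. t)"
    using t unfolding nash_equilibrium_def \<tau>_def[symmetric] by (force simp: \<tau>_def not_less)
  show "nonnull (utility P \<sigma> T f k) (\<lambda>_::'n. t)" if "0 < k"
  proof -
    have "0 < utility P \<sigma> T f k \<tau> i" for i
      unfolding util D_def using that P_pos Q[of i] t idle_in_unit[of t "others_idle \<tau> i"]
      by (intro mult_pos_pos divide_pos_pos down_pos) auto
    then show ?thesis
      unfolding nonnull_def \<tau>_def[symmetric] by (metis less_irrefl)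
  qed
qed

text \<open>A single station with nonzero utility forces \<open>p_AP \<tau> < 1\<close>, and then
  every station, not just that one, must sit at its crossing point. The crossing equations share the
  same \<open>h\<close> and are linear in \<open>\<tau> i\<close>, so all strategies agree.\<close>

lemma nash_equilibrium_homogeneous:
  fixes \<tau> :: "'n::finite \<Rightarrow> real"
  assumes nash: "nash_equilibrium {0..1} (utility P \<sigma> T f k) \<tau>"
    and nonnull: "nonnull (utility P \<sigma> T f k) \<tau>"
  obtains s where "\<tau> = (\<lambda>_. s)" "homogeneous_solution CARD('n) f k s"
proof -
  define n where "n = real CARD('n)"
  have n: "0 < n" by (simp add: n_def)
  define Q where "Q = others_idle \<tau>"
  define h where "h = f (p_AP \<tau>)"
  \<comment> \<open>The root \<open>x\<close> of the linear equation
    \<open>n * (x * (1 - h)) = k * (h * (1 - x))\<close>.\<close>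
  define s where "s = k * h / (n * (1 - h) + k * h)"
  have \<tau>: "\<tau> i \<in> {0..1}" for i
    using nash by (simp add: nash_equilibrium_def)
  have max: "utility P \<sigma> T f k (\<tau>(i := x)) i \<le> utility P \<sigma> T f k \<tau> i" if "x \<in> {0..1}" for i x
    using nash that by (auto simp: nash_equilibrium_def not_less)
  obtain i0 where i0: "utility P \<sigma> T f k \<tau> i0 \<noteq> 0"
    using nonnull by (auto simp: nonnull_def)
  \<comment> \<open>Staying silent guarantees utility 0, so a nonzero utility in equilibrium is
    positive.\<close>
  have "0 \<le> utility P \<sigma> T f k (\<tau>(i0 := 0)) i0"
    using k_nonneg P_pos others_idle_nonneg[of \<tau>, OF \<tau>] others_idle_le_1[of \<tau>, OF \<tau>]
    by (simp add: utility_fun_upd down_nonneg)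
  also have "\<dots> \<le> utility P \<sigma> T f k \<tau> i0"
    by (rule max) simp
  finally have "0 \<le> utility P \<sigma> T f k \<tau> i0" .
  with i0 have "0 < utility P \<sigma> T f k \<tau> i0" by simp
  then have D0: "0 < k * down (1 - p_AP \<tau>)"
    using P_pos by (auto simp: utility_eq p_AP_eq[of _ i0] zero_less_mult_iff zero_less_divide_iff)
  with k_nonneg have k: "0 < k"
    by (auto simp: zero_less_mult_iff)
  have "p_AP \<tau> \<noteq> 1"
    \<comment> \<open>If \<open>p_AP \<tau>\<close> were 1, the downlink throughput would vanish by
      \<open>down_0\<close>. A station with access probability 1 would cause exactly this, so there
      is none.\<close>
    using D0 by auto
  then have lt1: "\<tau> i < 1" for i
    using \<tau>[of i] by (cases "\<tau> i = 1") (auto simp: p_AP_eq[of _ i])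
  have Q: "0 < Q i" "Q i \<le> 1" for i
    using lt1 others_idle_le_1[OF \<tau>] by (auto simp: Q_def others_idle_def intro!: prod_pos)
  have eq: "n * (\<tau> i * (1 - h)) = k * (h * (1 - \<tau> i))" for i
  proof -
    \<comment> \<open>Equilibrium makes \<open>\<tau> i\<close> a maximiser over
      \<open>[0,1]\<close>; restricting the comparison to \<open>[0,1)\<close> loses nothing since
      \<open>\<tau> i < 1\<close>.\<close>
    have "up (Q i) (\<tau> i) = k / n * down ((1 - \<tau> i) * Q i)"
    proof (rule max_min_at_crossing[where U = "up (Q i)" and D = "\<lambda>x. k / n * down ((1 - x) * Q i)"])
      show "strict_mono_on {0..<1} (up (Q i))"
        using up_strict_mono Q by (auto intro!: strict_mono_onI)
      show "continuous_on {0..<1} (up (Q i))"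
        by (intro continuous_on_up Q)
      have "down ((1 - y) * Q i) < down ((1 - x) * Q i)" if "0 \<le> x" "x < y" "y < 1" for x y
        using that Q[of i] idle_in_unit[of x "Q i"] by (intro down_strict_mono) auto
      then show "strict_antimono_on {0..<1} (\<lambda>x. k / n * down ((1 - x) * Q i))"
        using k n by (auto intro!: monotone_onI divide_strict_right_mono)
      show "continuous_on {0..<1} (\<lambda>x. k / n * down ((1 - x) * Q i))"
        by (intro continuous_intros continuous_on_down Q)
      show "up (Q i) 0 \<le> k / n * down ((1 - 0) * Q i)"
        using k n down_pos[of "Q i"] Q by (auto intro: less_imp_le)
      show "\<tau> i \<in> {0..<1}"
        using \<tau>[of i] lt1[of i] by auto
      show "min (up (Q i) x) (k / n * down ((1 - x) * Q i))
          \<le> min (up (Q i) (\<tau> i)) (k / n * down ((1 - \<tau> i) * Q i))" if "x \<in> {0..<1}" for x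
        using max[of x i] that P_pos by (simp add: utility_fun_upd utility_eq[of \<tau>] Q_def n_def)
    qed
    then show ?thesis
      using up_eq_down_iff[of "Q i" "\<tau> i" n] Q \<tau>[of i] n
      by (simp add: h_def p_AP_eq[of _ i] Q_def)
  qed
  have p: "p_AP \<tau> \<in> {0..1}"
    using idle_in_unit[of "\<tau> i0" "Q i0"] \<tau>[of i0] Q[of i0] by (auto simp: p_AP_eq[of _ i0] Q_def)
  then have h: "0 < h" "h < 1"
    using f_pos f_less_1 by (auto simp: h_def)
  then have "0 < n * (1 - h) + k * h"
    using k n by (intro add_pos_pos mult_pos_pos) auto
  then have "\<tau> i = s" for i
    using eq[of i] by (simp add: s_def field_simps)
  then have \<tau>_const: "\<tau> = (\<lambda>_. s)" by auto
  have "homogeneous_solution CARD('n) f k s"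
    using eq[of i0] \<tau>[of i0] lt1[of i0]
    by (simp add: homogeneous_solution_iff n_def h_def \<tau>_const p_AP_const)
  with \<tau>_const show thesis by (rule that)
qed

end

text \<open>The existence and uniqueness of the solution are part of the claim. For
  \<open>k = 0\<close> every utility on the strategy space is 0, so no equilibrium is non-null; this
  is why \<open>nonnull\<close> is asserted for \<open>k > 0\<close> only, while the uniqueness part
  covers every \<open>k \<ge> 0\<close>.\<close>

theorem proposition2p3:
  fixes P \<sigma> T CWmin CWmax k :: real and R :: nat
    and f :: "real \<Rightarrow> real"
    and J :: "('n::finite \<Rightarrow> real) \<Rightarrow> 'n \<Rightarrow> real"
  assumes "P > 0" and "0 < \<sigma>" and "\<sigma> < T"
    and "1 < CWmin" and "CWmin \<le> CWmax"
    and f_def: "f = access_prob R CWmin CWmax"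
    and f_range: "f \<in> {0..1} \<rightarrow> {0<..<1}"
    and "0 \<le> k"
    and J_def: "J = utility P \<sigma> T f k"
  shows "(\<exists>!t. homogeneous_solution CARD('n) f k t) \<and>
    (\<forall>t. homogeneous_solution CARD('n) f k t \<longrightarrow>
       nash_equilibrium {0..1} J (\<lambda>_. t) \<and>
       (k > 0 \<longrightarrow> nonnull J (\<lambda>_. t)) \<and>
       (\<forall>\<tau>. nash_equilibrium {0..1} J \<tau> \<and> nonnull J \<tau> \<longrightarrow> \<tau> = (\<lambda>_. t)))"
proof -
  interpret access_game P \<sigma> T k f
  proof
    show "0 < f p" "f p < 1" if "p \<in> {0..1}" for p
      using f_range that by auto
    show "f q \<le> f p" if "0 \<le> p" "p \<le> q" "q < 1" for p q
      unfolding f_def using that assms by (intro access_prob_antimono) auto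
    show "continuous_on {0..<1} f"
      unfolding f_def using assms by (intro continuous_on_access_prob) auto
  qed (use assms in auto)
  have unique: "s = t"
    if "homogeneous_solution CARD('n) f k s" "homogeneous_solution CARD('n) f k t" for s t
    using homogeneous_solution_le[OF _ that] homogeneous_solution_le[OF _ that(2,1)]
    by (simp add: antisym)
  have "\<exists>!t. homogeneous_solution CARD('n) f k t"
    using homogeneous_solution_exists[of "CARD('n)"] unique by auto
  moreover have "\<tau> = (\<lambda>_. t)"
    if "homogeneous_solution CARD('n) f k t" "nash_equilibrium {0..1} J \<tau>" "nonnull J \<tau>" for t \<tau>
    using nash_equilibrium_homogeneous[of \<tau>] that unique unfolding J_def by metis
  ultimately show ?thesis
    using homogeneous_nash_equilibrium unfolding J_def by blast
qed

end
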